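(* Let $x(0)=0$. Then the optimal solution to the optimization problem $$\text{(P.2)}\qquad \max_{U^a}\ \sum_{k=1}^T\overline x(k)^{\mathsf T}\overline x(k)\quad\text{subject to}\quad (U^a)^{\mathsf T}M_cU^a\le\widetilde\delta_c,\qquad \overline x(k+1)=A\overline x(k)+B^au^a(k)$$ is $$U^*_c=\left(\sqrt{\frac{\widetilde\delta_c}{(\nu^* )^{\mathsf T}M_c\,\nu^*}}\right)\nu^*,$$ and its associated optimal cost is $$J^*_c=\widetilde\delta_c\,\rho_{\max}\left(\mathcal B_a^{\mathsf T}\mathcal B_a,M_c\right),$$ where $\nu^*=\nu_{\max}\left(\mathcal B_a^{\mathsf T}\mathcal B_a,M_c\right)$ and $$\mathcal B_a=\begin{bmatrix}B^a&\cdots&0\\ \vdots&\ddots&\vdots\\ A^{T-1}B^a&\cdots&B^a\end{bmatrix}.$$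
   Context: For a matrix pair $(A',B')$, $\rho_{\max}(A',B')$ denotes a largest generalized eigenvalue of the pair (values $\rho$ with $A'\nu=\rho B'\nu$ for some $\nu\neq0$), and $\nu_{\max}(A',B')$ one of its associated generalized eigenvectors. System: $x(k+1)=Ax(k)+B^au^a(k)+w(k)$, $y(k)=Cx(k)+v(k)$, with independent (over time and of each other) Gaussian noises $w(k)\sim\mathcal N(0,\Sigma_w)$, $v(k)\sim\mathcal N(0,\Sigma_v)$, deterministic initial state $x(0)$ and deterministic attack $u^a$. It is the stacked form of $N$ interconnected subsystems: $A=[A_{ij}]_{i,j=1}^N$, and $B^a$, $C$, $\Sigma_w$, $\Sigma_v$ are block diagonal with $N$ blocks. Fix a horizon $T>0$ and let $U^a=[u^a(0)^{\mathsf T}\cdots u^a(T-1)^{\mathsf T}]^{\mathsf T}$. In (P.2), $\overline x(k)=\mathbb E[x(k)]$, so $\overline x(0)=x(0)$. Define $\mathcal O_c=[(CA)^{\mathsf T}\cdots(CA^T)^{\mathsf T}]^{\mathsf T}$, and let $\mathcal F^{(a)}_c$, $\mathcal F^{(w)}_c$ be the $T\times T$ block matrices whose $(j,l)$ block is $CA^{j-l}B^a$, resp. $CA^{j-l}$, for $j\ge l$ and $0$ for $j<l$. Let the rows of $N_c$ form a basis of the left null space of $\mathcal O_c$, assumed nontrivial. Let $\Sigma_c=N_c[\mathcal F^{(w)}_c(I_T\otimes\Sigma_w)(\mathcal F^{(w)}_c)^{\mathsf T}+(I_T\otimes\Sigma_v)]N_c^{\mathsf T}$, assumed invertible, and $M_c=(N_c\mathcal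 F^{(a)}_c)^{\mathsf T}\Sigma_c^{-1}(N_c\mathcal F^{(a)}_c)$, $p_c=\mathrm{Rank}(\Sigma_c)$. Let $Q(\tau;p,\lambda)$ be the complementary cumulative distribution function at $\tau$ of the noncentral chi-squared distribution with $p$ degrees of freedom and noncentrality parameter $\lambda$. The threshold $\tau_c\ge0$ is fixed by the given false alarm probability $P^F_c=Q(\tau_c;p_c,0)$. For a detectability tolerance $P^F_c\le\delta_c\le1$, $\widetilde\delta_c=Q^{-1}_{p_c,\tau_c}(\delta_c)\in[0,\infty]$, where $Q^{-1}_{p_c,\tau_c}$ is the inverse of the (increasing) function $\lambda\mapsto Q(\tau_c;p_c,\lambda)$ for fixed $p_c,\tau_c$.
   Formalization: For singular M_c the claim with finite eigenvalues fails (problem unbounded), so ∞ counts as a generalized eigenvalue when M_cν=0 and B_a^T B_a ν≠0; U* is claimed optimal only if ρ_max and δ̃_c are finite, and the cost formula excludes 0·∞. *)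

theory Defs
  imports
    "HOL-Probability.Distributions"
    "Jordan_Normal_Form.Matrix_Kernel"
    "Jordan_Normal_Form.DL_Rank"
    "Jordan_Normal_Form.Gauss_Jordan_Elimination"
begin

unbundle no vec_syntax
unbundle no inner_syntax

definition block_mat ::
  "nat \<Rightarrow> nat \<Rightarrow> nat \<Rightarrow> nat \<Rightarrow> (nat \<Rightarrow> nat \<Rightarrow> real mat) \<Rightarrow> real mat" where
  \<comment> \<open>\<open>p \<times> q\<close> blocks of size \<open>r \<times> c\<close>; block indices start at 0\<close>
  "block_mat p q r c F =
     mat (p * r) (q * c) (\<lambda>(i, k). F (i div r) (k div c) $$ (i mod r, k mod c))"

definition kron_id :: "nat \<Rightarrow> real mat \<Rightarrow> real mat" where
  \<comment> \<open>the Kronecker product of the identity of size \<open>T\<close> with \<open>S\<close>\<close>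
  "kron_id T S = block_mat T T (dim_row S) (dim_col S)
     (\<lambda>j l. if j = l then S else 0\<^sub>m (dim_row S) (dim_col S))"

definition lower_block_toeplitz ::
  "nat \<Rightarrow> nat \<Rightarrow> nat \<Rightarrow> (nat \<Rightarrow> real mat) \<Rightarrow> real mat" where
  "lower_block_toeplitz T r c G =
     block_mat T T r c (\<lambda>j l. if l \<le> j then G (j - l) else 0\<^sub>m r c)"

definition covariance_mat :: "nat \<Rightarrow> real mat \<Rightarrow> bool" where
  "covariance_mat n S \<longleftrightarrow>
     S \<in> carrier_mat n n \<and> S\<^sup>T = S \<and> (\<forall>v\<in>carrier_vec n. 0 \<le> v \<bullet> (S *\<^sub>v v))"

definition obs_c :: "nat \<Rightarrow> real mat \<Rightarrow> real mat \<Rightarrow> real mat" where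
  "obs_c T A C = block_mat T 1 (dim_row C) (dim_col C) (\<lambda>j _. C * A ^\<^sub>m (j + 1))"

definition F_a :: "nat \<Rightarrow> real mat \<Rightarrow> real mat \<Rightarrow> real mat \<Rightarrow> real mat" where
  "F_a T A B C = lower_block_toeplitz T (dim_row C) (dim_col B) (\<lambda>i. C * A ^\<^sub>m i * B)"

definition F_w :: "nat \<Rightarrow> real mat \<Rightarrow> real mat \<Rightarrow> real mat" where
  "F_w T A C = lower_block_toeplitz T (dim_row C) (dim_col C) (\<lambda>i. C * A ^\<^sub>m i)"

definition B_stack :: "nat \<Rightarrow> real mat \<Rightarrow> real mat \<Rightarrow> real mat" where
  "B_stack T A B = lower_block_toeplitz T (dim_row B) (dim_col B) (\<lambda>i. A ^\<^sub>m i * B)"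

definition left_null_basis :: "real mat \<Rightarrow> real mat \<Rightarrow> bool" where
  \<comment> \<open>the rows of \<open>Nc\<close>, without repetition, are a basis of \<open>{z. z\<^sup>T Oc = 0}\<close>\<close>
  "left_null_basis Nc Oc \<longleftrightarrow>
     dim_col Nc = dim_row Oc \<and> distinct (rows Nc) \<and>
     kernel.basis (dim_row Oc) (Oc\<^sup>T) (set (rows Nc))"

definition Sigma_c ::
  "nat \<Rightarrow> real mat \<Rightarrow> real mat \<Rightarrow> real mat \<Rightarrow> real mat \<Rightarrow> real mat \<Rightarrow> real mat" where
  "Sigma_c T A C Sw Sv Nc =
     Nc * (F_w T A C * kron_id T Sw * (F_w T A C)\<^sup>T + kron_id T Sv) * Nc\<^sup>T"

definition M_c ::
  "nat \<Rightarrow> real mat \<Rightarrow> real mat \<Rightarrow> real mat \<Rightarrow> real mat \<Rightarrow> real mat \<Rightarrow> real mat \<Rightarrow> real mat" where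
  "M_c T A B C Sw Sv Nc =
     (Nc * F_a T A B C)\<^sup>T * the (mat_inverse (Sigma_c T A C Sw Sv Nc)) * (Nc * F_a T A B C)"

text \<open>The law of the sum of squares of \<open>p\<close> independent unit-variance Gaussians depends on their
  means only through the sum \<open>\<lambda>\<close> of the squared means; here all of \<open>\<lambda>\<close> is put on the first one.\<close>

definition noncentral_chi_squared :: "nat \<Rightarrow> real \<Rightarrow> real measure" where
  "noncentral_chi_squared p l =
     distr (\<Pi>\<^sub>M i\<in>{..<p}. density lborel
              (\<lambda>x. ennreal (normal_density (if i = 0 then sqrt l else 0) 1 x)))
           borel (\<lambda>z. \<Sum>i<p. (z i)\<^sup>2)"

text \<open>The value at \<open>\<lambda> = \<infinity>\<close> is the limit for \<open>\<lambda> \<rightarrow> \<infinity>\<close>, so that the inverse of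
  \<open>\<lambda> \<mapsto> Q \<tau> p \<lambda>\<close> is also defined at 1. Only \<open>\<lambda> \<ge> 0\<close> is meaningful.\<close>

definition chi_ccdf :: "real \<Rightarrow> nat \<Rightarrow> ereal \<Rightarrow> real" where
  "chi_ccdf \<tau> p l =
     (case l of ereal s \<Rightarrow> measure (noncentral_chi_squared p s) {\<tau><..} | _ \<Rightarrow> 1)"

text \<open>Finite eigenvalues are the real \<open>\<rho>\<close> with \<open>A' \<nu> = \<rho> B' \<nu>\<close> for some \<open>\<nu> \<noteq> 0\<close>. As usual for
  matrix pairs with singular \<open>B'\<close>, a vector with \<open>B' \<nu> = 0\<close> and \<open>A' \<nu> \<noteq> 0\<close> belongs to the
  eigenvalue \<open>\<infinity>\<close>.\<close>

definition gen_eigenpair :: "real mat \<Rightarrow> real mat \<Rightarrow> ereal \<Rightarrow> real vec \<Rightarrow> bool" where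
  "gen_eigenpair A' B' \<rho> \<nu> \<longleftrightarrow>
     \<nu> \<in> carrier_vec (dim_col A') \<and> \<nu> \<noteq> 0\<^sub>v (dim_col A') \<and>
     (case \<rho> of
        ereal r \<Rightarrow> A' *\<^sub>v \<nu> = r \<cdot>\<^sub>v (B' *\<^sub>v \<nu>)
      | PInfty \<Rightarrow> B' *\<^sub>v \<nu> = 0\<^sub>v (dim_row B') \<and> A' *\<^sub>v \<nu> \<noteq> 0\<^sub>v (dim_row A')
      | MInfty \<Rightarrow> False)"

definition max_gen_eigenpair :: "real mat \<Rightarrow> real mat \<Rightarrow> ereal \<Rightarrow> real vec \<Rightarrow> bool" where
  "max_gen_eigenpair A' B' \<rho> \<nu> \<longleftrightarrow>
     gen_eigenpair A' B' \<rho> \<nu> \<and> (\<forall>\<rho>' \<nu>'. gen_eigenpair A' B' \<rho>' \<nu>' \<longrightarrow> \<rho>' \<le> \<rho>)"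

definition attack :: "nat \<Rightarrow> real vec \<Rightarrow> nat \<Rightarrow> real vec" where
  \<comment> \<open>the component \<open>u(k)\<close>, of dimension \<open>m\<close>, of the stacked attack \<open>U\<close>\<close>
  "attack m U k = vec m (\<lambda>i. U $ (k * m + i))"

text \<open>The recursion for \<open>E[x(k)]\<close>: the noises have mean zero and drop out.\<close>

primrec mean_state :: "real mat \<Rightarrow> real mat \<Rightarrow> real vec \<Rightarrow> real vec \<Rightarrow> nat \<Rightarrow> real vec" where
  "mean_state A B x0 U 0 = x0"
| "mean_state A B x0 U (Suc k) =
     A *\<^sub>v mean_state A B x0 U k + B *\<^sub>v attack (dim_col B) U k"

definition P2_cost :: "nat \<Rightarrow> real mat \<Rightarrow> real mat \<Rightarrow> real vec \<Rightarrow> real vec \<Rightarrow> real" where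
  "P2_cost T A B x0 U = (\<Sum>k=1..T. mean_state A B x0 U k \<bullet> mean_state A B x0 U k)"

definition P2_feasible :: "nat \<Rightarrow> real mat \<Rightarrow> real mat \<Rightarrow> ereal \<Rightarrow> real vec set" where
  "P2_feasible T B M \<delta>' =
     {U \<in> carrier_vec (T * dim_col B). ereal (U \<bullet> (M *\<^sub>v U)) \<le> \<delta>'}"

text \<open>The optimum need not be unique (\<open>-U\<close> is optimal whenever \<open>U\<close> is).\<close>

definition P2_solution ::
  "nat \<Rightarrow> real mat \<Rightarrow> real mat \<Rightarrow> real vec \<Rightarrow> real mat \<Rightarrow> ereal \<Rightarrow> real vec \<Rightarrow> bool" where
  "P2_solution T A B x0 M \<delta>' U \<longleftrightarrow>
     U \<in> P2_feasible T B M \<delta>' \<and>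
     (\<forall>V \<in> P2_feasible T B M \<delta>'. P2_cost T A B x0 V \<le> P2_cost T A B x0 U)"

definition P2_value ::
  "nat \<Rightarrow> real mat \<Rightarrow> real mat \<Rightarrow> real vec \<Rightarrow> real mat \<Rightarrow> ereal \<Rightarrow> ereal" where
  "P2_value T A B x0 M \<delta>' = (SUP U \<in> P2_feasible T B M \<delta>'. ereal (P2_cost T A B x0 U))"

end

theory Submission
  imports Defs
begin

text \<open>With $x(0) = 0$ the stacked mean trajectory is $\mathcal B_a U$, so the cost of an attack $U$ is
  the quadratic form of $S = \mathcal B_a^T \mathcal B_a$, and (P.2) maximizes the form of $S$
  under a bound on the form of the positive semidefinite matrix $M$. Everything therefore rests on
  the pair $(S, M)$ (\<open>P2_cost_eq_quadratic_form\<close>, \<open>covariance_mat_M_c\<close>).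

  If the largest generalized eigenvalue is a real number $r$, then $M$ is positive definite: a
  nonzero vector of the kernel of $M$ would either be an eigenvector for $\infty$ or lie in both kernels
  and so be an eigenvector for every real number. The quotient of the two forms is then continuous
  on the unit sphere and attains a maximum, which is an eigenvalue, so that
  $x^T S x \le r\, x^T M x$ for all $x$ (\<open>finite_max_gen_eigenpair_bounds\<close>). Under the constraint
  the cost is thus at most $\widetilde\delta r$, and the eigenvector scaled to
  $U^T M U = \widetilde\delta$ reaches this bound.

  If the largest eigenvalue is $\infty$, its eigenvector changes the state without being
  penalized by $M$; multiples of it are feasible at arbitrarily large cost. The same
  happens for any eigenvector of positive eigenvalue when the tolerance is infinite.

  That the maximal quotient is an eigenvalue is obtained from semidefiniteness alone: the matrix
  $r M - S$ is positive semidefinite and its form vanishes at the maximizer, hence the matrix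
  itself annihilates the maximizer (\<open>covariance_mat_null_vector\<close>).\<close>

section \<open>Positive semidefinite matrices\<close>

lemma covariance_matD:
  "covariance_mat n K \<Longrightarrow> K \<in> carrier_mat n n"
  "covariance_mat n K \<Longrightarrow> K\<^sup>T = K"
  "covariance_mat n K \<Longrightarrow> v \<in> carrier_vec n \<Longrightarrow> 0 \<le> v \<bullet> (K *\<^sub>v v)"
  by (auto simp: covariance_mat_def)

lemma scalar_prod_self_nonneg: fixes v :: "real vec" shows "0 \<le> v \<bullet> v"
  unfolding scalar_prod_def by (intro sum_nonneg) auto

lemma scalar_prod_self_eq_0:
  fixes v :: "real vec"
  assumes "v \<in> carrier_vec n" "v \<bullet> v = 0"
  shows "v = 0\<^sub>v n"
proof
  have "\<forall>i\<in>{0..<dim_vec v}. v $ i * v $ i = 0"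
    using assms(2) unfolding scalar_prod_def by (subst (asm) sum_nonneg_eq_0_iff) auto
  then show "v $ i = 0\<^sub>v n $ i" if "i < dim_vec (0\<^sub>v n :: real vec)" for i
    using that assms(1) by auto
qed (use assms in auto)

lemma quadratic_form_smult:
  fixes M :: "real mat"
  assumes "M \<in> carrier_mat n n" "x \<in> carrier_vec n"
  shows "(c \<cdot>\<^sub>v x) \<bullet> (M *\<^sub>v (c \<cdot>\<^sub>v x)) = c\<^sup>2 * (x \<bullet> (M *\<^sub>v x))"
  using assms by (simp add: mult_mat_vec power2_eq_square)

text \<open>If the form of $K$ vanishes at $x$, then along the line $x + t K x$ it is $2 t\,\lVert K x\rVert^2 + O(t^2)$; it would become
  negative for small negative $t$ unless $K x = 0$.\<close>

lemma covariance_mat_null_vector: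
  assumes K: "covariance_mat n K" and x: "x \<in> carrier_vec n" and null: "x \<bullet> (K *\<^sub>v x) = 0"
  shows "K *\<^sub>v x = 0\<^sub>v n"
proof -
  have Kc: "K \<in> carrier_mat n n" and sym: "K\<^sup>T = K"
    and psd: "\<And>v. v \<in> carrier_vec n \<Longrightarrow> 0 \<le> v \<bullet> (K *\<^sub>v v)"
    using K by (auto simp: covariance_mat_def)
  define y where "y = K *\<^sub>v x"
  define a b where "a = y \<bullet> y" and "b = y \<bullet> (K *\<^sub>v y)"
  have y: "y \<in> carrier_vec n" using Kc x by (simp add: y_def)
  have b: "0 \<le> b" using psd[OF y] by (simp add: b_def)
  have cross: "x \<bullet> (K *\<^sub>v y) = a"
    using transpose_vec_mult_scalar[OF Kc y x] sym by (simp add: a_def y_def)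
  \<comment> \<open>the minimizer of \<open>2ta + bt\<^sup>2\<close> is \<open>-a/b\<close>; \<open>b + 1\<close> avoids a case distinction on \<open>b = 0\<close>\<close>
  define t where "t = - a / (b + 1)"
  have "0 \<le> (x + t \<cdot>\<^sub>v y) \<bullet> (K *\<^sub>v (x + t \<cdot>\<^sub>v y))" by (rule psd) (use x y in auto)
  also have "K *\<^sub>v (x + t \<cdot>\<^sub>v y) = y + t \<cdot>\<^sub>v (K *\<^sub>v y)"
    using Kc x y by (simp add: mult_add_distrib_mat_vec mult_mat_vec y_def)
  also have "(x + t \<cdot>\<^sub>v y) \<bullet> (y + t \<cdot>\<^sub>v (K *\<^sub>v y)) = 2 * t * a + t\<^sup>2 * b"
    using Kc x y null cross
    by (simp add: add_scalar_prod_distrib[of _ n] scalar_prod_add_distrib[of _ n] a_def b_def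
        y_def[symmetric] power2_eq_square algebra_simps)
  finally have "0 \<le> (2 * t * a + t\<^sup>2 * b) * (b + 1)\<^sup>2" by simp
  also have "\<dots> = 2 * (t * (b + 1)) * a * (b + 1) + (t * (b + 1))\<^sup>2 * b"
    by (simp add: power2_eq_square algebra_simps)
  also have "t * (b + 1) = - a" using b by (simp add: t_def)
  finally have "a\<^sup>2 * (b + 2) \<le> 0" by (simp add: power2_eq_square algebra_simps)
  then have "a = 0" using b by (simp add: mult_le_0_iff)
  then show ?thesis using scalar_prod_self_eq_0[OF y] by (simp add: a_def y_def)
qed

lemma covariance_mat_congruence:
  assumes K: "covariance_mat n K" and X: "X \<in> carrier_mat m n"
  shows "covariance_mat m (X * K * X\<^sup>T)"
proof -
  note Kc = covariance_matD(1)[OF K]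
  have "(X * K * X\<^sup>T)\<^sup>T = X * (X * K)\<^sup>T"
    by (subst transpose_mult[of _ m n _ m]) (use Kc X in auto)
  also have "(X * K)\<^sup>T = K * X\<^sup>T"
    by (subst transpose_mult[of _ m n _ n]) (use Kc X covariance_matD(2)[OF K] in auto)
  also have "X * (K * X\<^sup>T) = X * K * X\<^sup>T" using Kc X by (simp add: assoc_mult_mat[of _ m n _ n _ m])
  finally have sym: "(X * K * X\<^sup>T)\<^sup>T = X * K * X\<^sup>T" .
  have "0 \<le> v \<bullet> (X * K * X\<^sup>T *\<^sub>v v)" if v: "v \<in> carrier_vec m" for v
  proof -
    have w: "X\<^sup>T *\<^sub>v v \<in> carrier_vec n" using X v by simp
    have "X * K * X\<^sup>T *\<^sub>v v = X *\<^sub>v (K *\<^sub>v (X\<^sup>T *\<^sub>v v))"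
      using Kc X v by (simp add: assoc_mult_mat_vec[of _ m n _ m] assoc_mult_mat_vec[of _ m n _ n])
    then have "v \<bullet> (X * K * X\<^sup>T *\<^sub>v v) = (X\<^sup>T *\<^sub>v v) \<bullet> (K *\<^sub>v (X\<^sup>T *\<^sub>v v))"
      using transpose_vec_mult_scalar[OF X mult_mat_vec_carrier[OF Kc w] v] by simp
    then show ?thesis using covariance_matD(3)[OF K w] by simp
  qed
  then show ?thesis using sym Kc X by (auto simp: covariance_mat_def)
qed

lemma covariance_mat_add:
  assumes K: "covariance_mat n K" and L: "covariance_mat n L"
  shows "covariance_mat n (K + L)"
  using covariance_matD[OF K] covariance_matD[OF L]
  by (auto simp: covariance_mat_def transpose_add[of _ n n] add_mult_distrib_mat_vec[of _ n n]
      scalar_prod_add_distrib[of _ n])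

lemma covariance_mat_Gram:
  assumes X: "(X :: real mat) \<in> carrier_mat m n"
  shows "covariance_mat n (X\<^sup>T * X)"
proof -
  have "covariance_mat m (1\<^sub>m m)"
    by (auto simp: covariance_mat_def scalar_prod_self_nonneg)
  from covariance_mat_congruence[OF this, of "X\<^sup>T" n] show ?thesis using X by simp
qed

text \<open>The inverse $L$ is symmetric, so $L = L K L^T$ is congruent to $K$.\<close>

lemma covariance_mat_inverse:
  assumes K: "covariance_mat n K" and inv: "invertible_mat K"
  shows "covariance_mat n (the (mat_inverse K))"
proof -
  note Kc = covariance_matD[OF K]
  obtain J where KJ: "K * J = 1\<^sub>m n" and JK: "J * K = 1\<^sub>m (dim_row J)"
    using inv Kc(1) by (auto simp: invertible_mat_def inverts_mat_def)
  have J: "J \<in> carrier_mat n n"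
    using Kc(1) arg_cong[OF KJ, of dim_col] arg_cong[OF JK, of dim_col] by auto
  have "K \<in> Units (ring_mat TYPE(real) n ())"
    using Kc(1) J KJ JK by (auto simp: Units_def ring_mat_simps intro!: bexI[of _ J])
  then obtain L where L: "mat_inverse K = Some L"
    using mat_inverse(1)[OF Kc(1), of "()"] by (cases "mat_inverse K") auto
  note KL = mat_inverse(2)[OF Kc(1) L]
  have LT: "L\<^sup>T = L"
  proof -
    have "L\<^sup>T * K = 1\<^sub>m n"
      using KL Kc(2) transpose_mult[of K n n L n] Kc(1) by (metis transpose_one)
    then have "L\<^sup>T * K * L = L" using KL left_mult_one_mat[of L n n] by simp
    moreover have "L\<^sup>T * K * L = L\<^sup>T * (K * L)"
      using KL Kc(1) by (intro assoc_mult_mat[of _ n n _ n _ n]) auto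
    ultimately show ?thesis using KL right_mult_one_mat[of "L\<^sup>T" n n] by simp
  qed
  have "L = L * K * L\<^sup>T" using KL LT left_mult_one_mat[of L n n] by simp
  then show ?thesis using covariance_mat_congruence[OF K, of L n] KL L by simp
qed

section \<open>The largest generalized eigenvalue of a positive semidefinite pair\<close>

text \<open>The quotient is invariant under scaling, so a maximum over the unit sphere, which is compact,
  is a maximum over all vectors. The dimension $n$ is not
  part of the type of a vector, so the sphere is realized in the space of functions
  \<open>nat \<Rightarrow> real\<close> that vanish from $n$ on, where compactness comes from Tychonoff's theorem.\<close>

lemma Rayleigh_quotient_attains_max:
  fixes S M :: "real mat"
  assumes n: "0 < n" and S: "S \<in> carrier_mat n n" and M: "M \<in> carrier_mat n n"
    and pos: "\<And>x. x \<in> carrier_vec n \<Longrightarrow> x \<noteq> 0\<^sub>v n \<Longrightarrow> 0 < x \<bullet> (M *\<^sub>v x)"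
  obtains \<nu> where "\<nu> \<in> carrier_vec n" "\<nu> \<noteq> 0\<^sub>v n"
    "\<And>x. x \<in> carrier_vec n \<Longrightarrow>
       x \<bullet> (S *\<^sub>v x) \<le> (\<nu> \<bullet> (S *\<^sub>v \<nu>)) / (\<nu> \<bullet> (M *\<^sub>v \<nu>)) * (x \<bullet> (M *\<^sub>v x))"
proof -
  define form :: "real mat \<Rightarrow> (nat \<Rightarrow> real) \<Rightarrow> real"
    where "form K f = (\<Sum>i<n. f i * (\<Sum>j<n. K $$ (i, j) * f j))" for K f
  define cube :: "(nat \<Rightarrow> real) set"
    where "cube = Pi\<^sub>E UNIV (\<lambda>i. if i < n then {-1..1} else {0})"
  define sphere where "sphere = cube \<inter> {f. (\<Sum>i<n. (f i)\<^sup>2) = 1}"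
  have form: "x \<bullet> (K *\<^sub>v x) = form K (\<lambda>i. x $ i)"
    if "K \<in> carrier_mat n n" "x \<in> carrier_vec n" for K x
    using that by (auto simp: form_def scalar_prod_def lessThan_atLeast0 intro!: sum.cong)
  have form': "form K f = vec n f \<bullet> (K *\<^sub>v vec n f)" if "K \<in> carrier_mat n n" for K f
    by (subst form[OF that]) (auto simp: form_def intro!: sum.cong)
  have cont: "continuous_on A (form K)" for A K
    unfolding form_def
    by (intro continuous_intros continuous_on_subset[OF continuous_on_product_coordinates]) auto
  have "compactin (product_topology (\<lambda>_. euclidean) UNIV) cube"
    unfolding cube_def by (subst compactin_PiE) (auto simp: compactin_euclidean_iff)
  then have "compact cube" by (simp add: euclidean_product_topology compactin_euclidean_iff)
  moreover have "closed {f :: nat \<Rightarrow> real. (\<Sum>i<n. (f i)\<^sup>2) = 1}"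
    by (intro closed_Collect_eq continuous_intros
        continuous_on_subset[OF continuous_on_product_coordinates]) auto
  ultimately have compact: "compact sphere" unfolding sphere_def by (rule compact_Int_closed)
  have nz: "vec n f \<noteq> 0\<^sub>v n" if "f \<in> sphere" for f
  proof
    assume eq: "vec n f = 0\<^sub>v n"
    have "f i = 0" if "i < n" for i using arg_cong[OF eq, of "\<lambda>v. v $ i"] that by simp
    then show False using \<open>f \<in> sphere\<close> by (simp add: sphere_def)
  qed
  have Mpos: "0 < form M f" if "f \<in> sphere" for f
    using pos[OF _ nz[OF that]] form'[OF M] by simp
  have "(\<lambda>i. if i = 0 then 1 else 0) \<in> sphere"
  proof -
    have "(\<Sum>i<n. (if i = 0 then 1 else 0 :: real)\<^sup>2) = (\<Sum>i<n. if i = 0 then 1 else 0)"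
      by (intro sum.cong) auto
    then show ?thesis using n by (auto simp: sphere_def cube_def PiE_iff)
  qed
  then have "sphere \<noteq> {}" by blast
  moreover have "continuous_on sphere (\<lambda>f. form S f / form M f)"
    using Mpos by (intro continuous_intros cont) force
  ultimately obtain f where f: "f \<in> sphere"
    and max: "\<And>g. g \<in> sphere \<Longrightarrow> form S g / form M g \<le> form S f / form M f"
    using continuous_attains_sup[OF compact] by blast
  show thesis
  proof (rule that[of "vec n f"])
    show "vec n f \<noteq> 0\<^sub>v n" by (rule nz[OF f])
    fix x :: "real vec" assume x: "x \<in> carrier_vec n"
    show "x \<bullet> (S *\<^sub>v x) \<le> (vec n f \<bullet> (S *\<^sub>v vec n f)) / (vec n f \<bullet> (M *\<^sub>v vec n f)) * (x \<bullet> (M *\<^sub>v x))"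
    proof (cases "x = 0\<^sub>v n")
      case True
      then show ?thesis using S M by simp
    next
      case False
      define c where "c = sqrt (x \<bullet> x)"
      have xx: "x \<bullet> x \<noteq> 0" using scalar_prod_self_eq_0[OF x] False by blast
      then have c: "0 < c" using scalar_prod_self_nonneg[of x] by (simp add: c_def)
      have c2: "c\<^sup>2 = (\<Sum>i<n. (x $ i)\<^sup>2)"
        using x scalar_prod_self_nonneg[of x]
        by (auto simp: c_def scalar_prod_def power2_eq_square lessThan_atLeast0)
      \<comment> \<open>the normalized vector \<open>x\<close>, as a point of the sphere\<close>
      define g where "g = (\<lambda>i. if i < n then x $ i / c else 0)"
      have "- c \<le> x $ i \<and> x $ i \<le> c" if "i < n" for i
      proof -
        have "(x $ i)\<^sup>2 \<le> c\<^sup>2" unfolding c2 using that by (intro member_le_sum) auto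
        then show ?thesis using c by (simp add: abs_le_square_iff[symmetric] abs_le_iff)
      qed
      then have "g \<in> cube" using c by (auto simp: g_def cube_def field_simps)
      moreover have "(\<Sum>i<n. (g i)\<^sup>2) = 1"
        using c by (simp add: g_def power_divide sum_divide_distrib[symmetric] c2[symmetric])
      ultimately have g: "g \<in> sphere" by (simp add: sphere_def)
      have x_eq: "x = c \<cdot>\<^sub>v vec n g" using x c by (intro eq_vecI) (auto simp: g_def)
      have scale: "x \<bullet> (K *\<^sub>v x) = c\<^sup>2 * form K g" if "K \<in> carrier_mat n n" for K
        using quadratic_form_smult[OF that, of "vec n g" c] form'[OF that] x_eq by simp
      have "form S g \<le> form S f / form M f * form M g"
        using max[OF g] Mpos[OF g] by (simp add: pos_divide_le_eq)
      then have "c\<^sup>2 * form S g \<le> c\<^sup>2 * (form S f / form M f * form M g)"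
        by (intro mult_left_mono) auto
      then show ?thesis
        unfolding scale[OF S] scale[OF M] form'[OF S, symmetric] form'[OF M, symmetric]
        by (simp add: mult.left_commute)
    qed
  qed auto
qed

lemma minus_eq_0_vec_imp_eq:
  fixes v w :: "real vec"
  assumes "v \<in> carrier_vec n" "w \<in> carrier_vec n" and eq: "v - w = 0\<^sub>v n"
  shows "v = w"
proof (rule eq_vecI)
  fix i assume "i < dim_vec w"
  then show "v $ i = w $ i"
    using assms(1,2) arg_cong[OF eq, of "\<lambda>u. u $ i"] by simp
qed (use assms in auto)

lemma symmetric_mat_index:
  assumes "K \<in> carrier_mat n n" "K\<^sup>T = K" "i < n" "j < n"
  shows "K $$ (j, i) = K $$ (i, j)"
  using assms by (metis carrier_matD index_transpose_mat(1))

lemma smult_mat_mult_vec: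
  fixes X :: "real mat"
  assumes "X \<in> carrier_mat m n" "v \<in> carrier_vec n"
  shows "(c \<cdot>\<^sub>m X) *\<^sub>v v = c \<cdot>\<^sub>v (X *\<^sub>v v)"
  using assms by (intro eq_vecI) (auto simp: scalar_prod_def sum_distrib_left mult.assoc)

text \<open>The maximal value $r$ of the quotient is an eigenvalue: $K = r M - S$ is positive semidefinite
  and its form vanishes at the maximizer, which is thus in the kernel of $K$.\<close>

lemma top_gen_eigenvector:
  assumes n: "0 < n" and S: "S \<in> carrier_mat n n" "S\<^sup>T = S" and M: "covariance_mat n M"
    and pos: "\<And>x. x \<in> carrier_vec n \<Longrightarrow> x \<noteq> 0\<^sub>v n \<Longrightarrow> 0 < x \<bullet> (M *\<^sub>v x)"
  obtains r \<nu> where "\<nu> \<in> carrier_vec n" "\<nu> \<noteq> 0\<^sub>v n" "S *\<^sub>v \<nu> = r \<cdot>\<^sub>v (M *\<^sub>v \<nu>)"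
    "\<And>x. x \<in> carrier_vec n \<Longrightarrow> x \<bullet> (S *\<^sub>v x) \<le> r * (x \<bullet> (M *\<^sub>v x))"
proof -
  note Mc = covariance_matD[OF M]
  obtain \<nu> where \<nu>: "\<nu> \<in> carrier_vec n" "\<nu> \<noteq> 0\<^sub>v n"
    and dom: "\<And>x. x \<in> carrier_vec n \<Longrightarrow>
       x \<bullet> (S *\<^sub>v x) \<le> (\<nu> \<bullet> (S *\<^sub>v \<nu>)) / (\<nu> \<bullet> (M *\<^sub>v \<nu>)) * (x \<bullet> (M *\<^sub>v x))"
    using Rayleigh_quotient_attains_max[OF n S(1) Mc(1) pos] by blast
  define r where "r = (\<nu> \<bullet> (S *\<^sub>v \<nu>)) / (\<nu> \<bullet> (M *\<^sub>v \<nu>))"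
  define K where "K = r \<cdot>\<^sub>m M - S"
  have K_mult: "K *\<^sub>v x = r \<cdot>\<^sub>v (M *\<^sub>v x) - S *\<^sub>v x" if "x \<in> carrier_vec n" for x
    using S(1) Mc(1) that unfolding K_def
    by (subst minus_mult_distrib_mat_vec[of _ n n]) (auto simp: smult_mat_mult_vec)
  have K_form: "x \<bullet> (K *\<^sub>v x) = r * (x \<bullet> (M *\<^sub>v x)) - x \<bullet> (S *\<^sub>v x)" if "x \<in> carrier_vec n" for x
    using S(1) Mc(1) that by (simp add: K_mult scalar_prod_minus_distrib[of _ n])
  have "K\<^sup>T = K"
  proof (rule eq_matI)
    fix i j assume ij: "i < dim_row K" "j < dim_col K"
    have "M $$ (j, i) = M $$ (i, j)" "S $$ (j, i) = S $$ (i, j)"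
      using ij S(1) Mc(1) symmetric_mat_index[OF Mc(1,2), of i j] symmetric_mat_index[OF S, of i j]
      by (auto simp: K_def)
    then show "K\<^sup>T $$ (i, j) = K $$ (i, j)" using ij S(1) Mc(1) by (auto simp: K_def)
  qed (use S(1) Mc(1) in \<open>auto simp: K_def\<close>)
  then have "covariance_mat n K"
    using S(1) Mc(1) dom K_form by (auto simp: covariance_mat_def r_def K_def)
  moreover have "\<nu> \<bullet> (K *\<^sub>v \<nu>) = 0"
    using K_form[OF \<nu>(1)] pos[OF \<nu>] by (simp add: r_def)
  ultimately have "r \<cdot>\<^sub>v (M *\<^sub>v \<nu>) - S *\<^sub>v \<nu> = 0\<^sub>v n"
    using covariance_mat_null_vector[OF _ \<nu>(1)] K_mult[OF \<nu>(1)] by metis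
  then have "S *\<^sub>v \<nu> = r \<cdot>\<^sub>v (M *\<^sub>v \<nu>)"
    using minus_eq_0_vec_imp_eq[of "r \<cdot>\<^sub>v (M *\<^sub>v \<nu>)" n "S *\<^sub>v \<nu>"] S(1) Mc(1) \<nu>(1) by simp
  then show thesis using that[OF \<nu>] dom by (auto simp: r_def)
qed

text \<open>For a pair of semidefinite matrices, a finite largest eigenvalue is a strong hypothesis: it
  excludes the eigenvalue $\infty$ and also a common kernel (where every real number is
  an eigenvalue), which leaves only positive definite $M$. The second claim then compares $r$ with
  the eigenvalue at which the quotient attains its maximum.\<close>

lemma finite_max_gen_eigenpair_bounds:
  assumes S: "covariance_mat n S" and M: "covariance_mat n M"
    and max: "max_gen_eigenpair S M (ereal r) \<nu>"
  shows "x \<in> carrier_vec n \<Longrightarrow> x \<noteq> 0\<^sub>v n \<Longrightarrow> 0 < x \<bullet> (M *\<^sub>v x)"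
    and "x \<in> carrier_vec n \<Longrightarrow> x \<bullet> (S *\<^sub>v x) \<le> r * (x \<bullet> (M *\<^sub>v x))"
proof -
  have eig: "gen_eigenpair S M (ereal r) \<nu>"
    and le: "\<And>\<rho>' \<nu>'. gen_eigenpair S M \<rho>' \<nu>' \<Longrightarrow> \<rho>' \<le> ereal r"
    using max by (auto simp: max_gen_eigenpair_def)
  note Sc = covariance_matD[OF S] and Mc = covariance_matD[OF M]
  show pos: "0 < x \<bullet> (M *\<^sub>v x)" if x: "x \<in> carrier_vec n" "x \<noteq> 0\<^sub>v n" for x
  proof (rule ccontr)
    assume "\<not> 0 < x \<bullet> (M *\<^sub>v x)"
    then have Mx: "M *\<^sub>v x = 0\<^sub>v n"
      using Mc(3)[OF x(1)] covariance_mat_null_vector[OF M x(1)] by simp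
    show False
    proof (cases "S *\<^sub>v x = 0\<^sub>v n")
      case True
      then have "gen_eigenpair S M (ereal (r + 1)) x"
        using x Mx Sc(1) by (auto simp: gen_eigenpair_def)
      from le[OF this] show False by simp
    next
      case False
      then have "gen_eigenpair S M \<infinity> x"
        using x Mx Sc(1) Mc(1) by (auto simp: gen_eigenpair_def)
      from le[OF this] show False by simp
    qed
  qed
  assume x: "x \<in> carrier_vec n"
  have \<nu>: "\<nu> \<in> carrier_vec n" "\<nu> \<noteq> 0\<^sub>v n"
    using eig Sc(1) by (auto simp: gen_eigenpair_def)
  have "0 < n"
  proof (rule ccontr)
    assume "\<not> 0 < n"
    then have "\<nu> = 0\<^sub>v n" using \<nu>(1) by (intro eq_vecI) auto
    then show False using \<nu>(2) by simp
  qed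
  then obtain r' \<nu>' where \<nu>': "\<nu>' \<in> carrier_vec n" "\<nu>' \<noteq> 0\<^sub>v n" "S *\<^sub>v \<nu>' = r' \<cdot>\<^sub>v (M *\<^sub>v \<nu>')"
    and dom: "\<And>x. x \<in> carrier_vec n \<Longrightarrow> x \<bullet> (S *\<^sub>v x) \<le> r' * (x \<bullet> (M *\<^sub>v x))"
    using top_gen_eigenvector[OF _ Sc(1,2) M pos] by metis
  have "gen_eigenpair S M (ereal r') \<nu>'"
    using \<nu>' Sc(1) by (auto simp: gen_eigenpair_def)
  from le[OF this] have "r' \<le> r" by simp
  then show "x \<bullet> (S *\<^sub>v x) \<le> r * (x \<bullet> (M *\<^sub>v x))"
    using dom[OF x] Mc(3)[OF x] mult_right_mono[of r' r "x \<bullet> (M *\<^sub>v x)"] by linarith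
qed

text \<open>A common kernel makes every real number an eigenvalue, and then there need not be a largest
  one. Without it, either the kernel of $M$ supplies an eigenvector for $\infty$, or $M$ is positive
  definite and the maximal quotient is the largest eigenvalue.\<close>

lemma max_gen_eigenpair_exists:
  assumes n: "0 < n" and S: "covariance_mat n S" and M: "covariance_mat n M"
    and "\<And>x. x \<in> carrier_vec n \<Longrightarrow> S *\<^sub>v x = 0\<^sub>v n \<Longrightarrow> M *\<^sub>v x = 0\<^sub>v n \<Longrightarrow> x = 0\<^sub>v n"
  shows "\<exists>\<rho> \<nu>. max_gen_eigenpair S M \<rho> \<nu>"
proof (cases "\<exists>x\<in>carrier_vec n. x \<noteq> 0\<^sub>v n \<and> M *\<^sub>v x = 0\<^sub>v n")
  case True
  then obtain x where "x \<in> carrier_vec n" "x \<noteq> 0\<^sub>v n" "M *\<^sub>v x = 0\<^sub>v n" by blast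
  then have "max_gen_eigenpair S M \<infinity> x"
    using assms(4)[of x] covariance_matD(1)[OF S] covariance_matD(1)[OF M]
    by (auto simp: max_gen_eigenpair_def gen_eigenpair_def)
  then show ?thesis by blast
next
  case False
  note Sc = covariance_matD[OF S] and Mc = covariance_matD[OF M]
  have pos: "0 < x \<bullet> (M *\<^sub>v x)" if "x \<in> carrier_vec n" "x \<noteq> 0\<^sub>v n" for x
    using False that Mc(3)[OF that(1)] covariance_mat_null_vector[OF M that(1)] by force
  obtain r \<nu> where \<nu>: "\<nu> \<in> carrier_vec n" "\<nu> \<noteq> 0\<^sub>v n" "S *\<^sub>v \<nu> = r \<cdot>\<^sub>v (M *\<^sub>v \<nu>)"
    and dom: "\<And>x. x \<in> carrier_vec n \<Longrightarrow> x \<bullet> (S *\<^sub>v x) \<le> r * (x \<bullet> (M *\<^sub>v x))"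
    using top_gen_eigenvector[OF n Sc(1,2) M pos] by metis
  have "\<rho>' \<le> ereal r" if "gen_eigenpair S M \<rho>' \<nu>'" for \<rho>' \<nu>'
  proof -
    have \<nu>': "\<nu>' \<in> carrier_vec n" "\<nu>' \<noteq> 0\<^sub>v n"
      using that Sc(1) by (auto simp: gen_eigenpair_def)
    show ?thesis
    proof (cases \<rho>')
      case (real r')
      then have "S *\<^sub>v \<nu>' = r' \<cdot>\<^sub>v (M *\<^sub>v \<nu>')" using that by (simp add: gen_eigenpair_def)
      then have "r' * (\<nu>' \<bullet> (M *\<^sub>v \<nu>')) \<le> r * (\<nu>' \<bullet> (M *\<^sub>v \<nu>'))"
        using dom[OF \<nu>'(1)] \<nu>'(1) Mc(1) by simp
      then show ?thesis using pos[OF \<nu>'] real by simp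
    next
      case PInf
      then show ?thesis using that \<nu>' False Mc(1) by (auto simp: gen_eigenpair_def)
    qed auto
  qed
  moreover have "gen_eigenpair S M (ereal r) \<nu>"
    using \<nu> Sc(1) by (auto simp: gen_eigenpair_def)
  ultimately show ?thesis by (auto simp: max_gen_eigenpair_def)
qed

section \<open>Block matrices and stacked vectors\<close>

lemma sum_nat_blocks:
  "(\<Sum>j<T * m. f j) = (\<Sum>l<T. \<Sum>i<m. f (l * m + i))" for T m :: nat
proof -
  have "(\<Sum>i<m. f (l * m + i)) = sum f {l * m..<l * m + m}" for l
    using sum.shift_bounds_nat_ivl[of f 0 "l * m" m] by (simp add: lessThan_atLeast0 add.commute)
  then show ?thesis by (simp add: sum.nat_group)
qed

lemma scalar_prod_blocks:
  assumes "v \<in> carrier_vec (T * m)" "w \<in> carrier_vec (T * m)"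
  shows "v \<bullet> w = (\<Sum>k<T. attack m v k \<bullet> attack m w k)"
proof -
  have "v \<bullet> w = (\<Sum>j<T * m. v $ j * w $ j)"
    using assms by (simp add: scalar_prod_def lessThan_atLeast0)
  also have "\<dots> = (\<Sum>k<T. \<Sum>i<m. v $ (k * m + i) * w $ (k * m + i))" by (rule sum_nat_blocks)
  finally show ?thesis by (simp add: scalar_prod_def attack_def lessThan_atLeast0)
qed

lemma block_index_less:
  fixes k :: nat
  assumes "k < T" "i < r"
  shows "k * r + i < T * r"
proof -
  have "k * r + i < Suc k * r" using assms by simp
  also have "\<dots> \<le> T * r" using assms by (intro mult_right_mono) auto
  finally show ?thesis .
qed

text \<open>The component map \<open>attack\<close> serves here for arbitrary stacked vectors: it cuts out the $k$-th
  block of length $c$.\<close>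

lemma block_mat_mult_vec:
  assumes F: "\<And>l. l < q \<Longrightarrow> F k l \<in> carrier_mat r c" and U: "U \<in> carrier_vec (q * c)"
    and k: "k < p" and i: "i < r"
  shows "(block_mat p q r c F *\<^sub>v U) $ (k * r + i) = (\<Sum>l<q. (F k l *\<^sub>v attack c U l) $ i)"
proof -
  have ki: "k * r + i < p * r" by (rule block_index_less[OF k i])
  have "(block_mat p q r c F *\<^sub>v U) $ (k * r + i)
      = (\<Sum>j<q * c. block_mat p q r c F $$ (k * r + i, j) * U $ j)"
    using ki U by (auto simp: block_mat_def scalar_prod_def lessThan_atLeast0)
  also have "\<dots> = (\<Sum>l<q. \<Sum>j<c. F k l $$ (i, j) * U $ (l * c + j))"
    unfolding sum_nat_blocks
    using ki i block_index_less[of _ q _ c] by (intro sum.cong) (auto simp: block_mat_def)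
  also have "\<dots> = (\<Sum>l<q. (F k l *\<^sub>v attack c U l) $ i)"
  proof (intro sum.cong refl)
    fix l assume "l \<in> {..<q}"
    then have "F k l \<in> carrier_mat r c" using F by simp
    then show "(\<Sum>j<c. F k l $$ (i, j) * U $ (l * c + j)) = (F k l *\<^sub>v attack c U l) $ i"
      using i by (auto simp: scalar_prod_def attack_def lessThan_atLeast0)
  qed
  finally show ?thesis .
qed

text \<open>The matrix acts on each block separately, so its form is the sum of the forms of the blocks.\<close>

lemma covariance_mat_kron_id:
  assumes K: "covariance_mat n K"
  shows "covariance_mat (T * n) (kron_id T K)"
proof -
  note Kc = covariance_matD[OF K]
  have L: "kron_id T K \<in> carrier_mat (T * n) (T * n)"
    using Kc(1) by (auto simp: kron_id_def block_mat_def)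
  have "(kron_id T K)\<^sup>T = kron_id T K"
  proof (rule eq_matI)
    fix i j assume "i < dim_row (kron_id T K)" "j < dim_col (kron_id T K)"
    then have ij: "i < T * n" "j < T * n" using L by auto
    then have "0 < n" by (cases n) auto
    then have "K $$ (j mod n, i mod n) = K $$ (i mod n, j mod n)"
      by (intro symmetric_mat_index[OF Kc(1,2)]) auto
    then show "(kron_id T K)\<^sup>T $$ (i, j) = kron_id T K $$ (i, j)"
      using ij Kc(1) \<open>0 < n\<close> by (auto simp: kron_id_def block_mat_def)
  qed (use L in auto)
  moreover have "0 \<le> v \<bullet> (kron_id T K *\<^sub>v v)" if v: "v \<in> carrier_vec (T * n)" for v
  proof -
    have blocks: "attack n (kron_id T K *\<^sub>v v) k = K *\<^sub>v attack n v k" if k: "k < T" for k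
    proof (rule eq_vecI)
      fix i assume "i < dim_vec (K *\<^sub>v attack n v k)"
      then have i: "i < n" using Kc(1) by simp
      have "(kron_id T K *\<^sub>v v) $ (k * n + i)
          = (\<Sum>l<T. ((if k = l then K else 0\<^sub>m n n) *\<^sub>v attack n v l) $ i)"
        using block_mat_mult_vec[of T "\<lambda>j l. if j = l then K else 0\<^sub>m n n" k n n v T i] k i v Kc(1)
        unfolding kron_id_def carrier_matD[OF Kc(1)] by (simp del: index_mult_mat_vec)
      also have "\<dots> = (\<Sum>l<T. if k = l then (K *\<^sub>v attack n v l) $ i else 0)"
        using i by (intro sum.cong) (auto simp: attack_def)
      finally show "attack n (kron_id T K *\<^sub>v v) k $ i = (K *\<^sub>v attack n v k) $ i"
        using i k by (simp add: attack_def)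
    qed (use Kc(1) in \<open>auto simp: attack_def\<close>)
    have "v \<bullet> (kron_id T K *\<^sub>v v) = (\<Sum>k<T. attack n v k \<bullet> (K *\<^sub>v attack n v k))"
      using scalar_prod_blocks[OF v mult_mat_vec_carrier[OF L v]] blocks by simp
    also have "0 \<le> \<dots>" by (intro sum_nonneg Kc(3)) (auto simp: attack_def)
    finally show ?thesis .
  qed
  ultimately show ?thesis using L by (simp add: covariance_mat_def)
qed

text \<open>$M_c$ is built from the two noise covariances by block-diagonal repetition, congruence,
  addition and inversion, each of which preserves symmetry and semidefiniteness.\<close>

lemma covariance_mat_M_c:
  assumes A: "A \<in> carrier_mat n n" and B: "B \<in> carrier_mat n m" and C: "C \<in> carrier_mat r n"
    and Sw: "covariance_mat n Sw" and Sv: "covariance_mat r Sv"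
    and Nc: "dim_col Nc = T * r" and inv: "invertible_mat (Sigma_c T A C Sw Sv Nc)"
  shows "covariance_mat (T * m) (M_c T A B C Sw Sv Nc)"
proof -
  have Nc': "Nc \<in> carrier_mat (dim_row Nc) (T * r)" using Nc by auto
  have F: "F_w T A C \<in> carrier_mat (T * r) (T * n)" "F_a T A B C \<in> carrier_mat (T * r) (T * m)"
    using B C by (auto simp: F_w_def F_a_def lower_block_toeplitz_def block_mat_def)
  have "covariance_mat (T * r) (F_w T A C * kron_id T Sw * (F_w T A C)\<^sup>T + kron_id T Sv)"
    by (intro covariance_mat_add covariance_mat_congruence[OF covariance_mat_kron_id[OF Sw] F(1)]
        covariance_mat_kron_id[OF Sv])
  then have "covariance_mat (dim_row Nc) (Sigma_c T A C Sw Sv Nc)"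
    unfolding Sigma_c_def by (rule covariance_mat_congruence[OF _ Nc'])
  from covariance_mat_inverse[OF this inv]
  have "covariance_mat (dim_row Nc) (the (mat_inverse (Sigma_c T A C Sw Sv Nc)))" .
  moreover have "(Nc * F_a T A B C)\<^sup>T \<in> carrier_mat (T * m) (dim_row Nc)"
    using mult_carrier_mat[OF Nc' F(2)] by (simp only: transpose_carrier_mat)
  ultimately have "covariance_mat (T * m) ((Nc * F_a T A B C)\<^sup>T *
      the (mat_inverse (Sigma_c T A C Sw Sv Nc)) * ((Nc * F_a T A B C)\<^sup>T)\<^sup>T)"
    by (rule covariance_mat_congruence)
  then show ?thesis by (simp add: M_c_def)
qed

section \<open>The cost as a quadratic form\<close>

lemma pow_mat_Suc_left:
  fixes A :: "real mat"
  assumes A: "A \<in> carrier_mat n n"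
  shows "A ^\<^sub>m Suc k = A * A ^\<^sub>m k"
proof (induction k)
  case (Suc k)
  have "A ^\<^sub>m Suc (Suc k) = A * A ^\<^sub>m k * A" by (simp add: Suc[symmetric])
  also have "\<dots> = A * A ^\<^sub>m Suc k" using A by (simp add: assoc_mult_mat[of _ n n _ n _ n])
  finally show ?case .
qed (use A in auto)

text \<open>The variation-of-constants formula
  $\overline x(k) = \sum_{l<k} A^{k-1-l} B u(l)$ for a system started at $0$.\<close>

lemma mean_state_convolution:
  assumes A: "A \<in> carrier_mat n n" and B: "B \<in> carrier_mat n m" and i: "i < n"
  shows "mean_state A B (0\<^sub>v n) U k $ i
    = (\<Sum>l<k. ((A ^\<^sub>m (k - 1 - l) * B) *\<^sub>v attack m U l) $ i)"
  using i
proof (induction k arbitrary: i)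
  case (Suc k)
  let ?x = "mean_state A B (0\<^sub>v n) U k"
  let ?P = "\<lambda>j l. (A ^\<^sub>m j * B) *\<^sub>v attack m U l"
  have u: "attack m U l \<in> carrier_vec m" for l by (simp add: attack_def)
  have carr: "A ^\<^sub>m j * B \<in> carrier_mat n m" for j
    by (rule mult_carrier_mat[OF pow_carrier_mat[OF A] B])
  have x: "?x \<in> carrier_vec n" using A B by (cases k) (auto intro!: carrier_vecI)
  have step: "A *\<^sub>v ?P (k - 1 - l) l = ?P (k - l) l" if "l < k" for l
  proof -
    have "A * (A ^\<^sub>m (k - 1 - l) * B) = A ^\<^sub>m Suc (k - 1 - l) * B"
      using A B by (simp add: pow_mat_Suc_left[OF A] assoc_mult_mat[of _ n n _ n _ m] del: pow_mat.simps)
    also have "Suc (k - 1 - l) = k - l" using that by simp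
    finally show ?thesis
      using assoc_mult_mat_vec[OF A carr u] by metis
  qed
  have "(A *\<^sub>v ?x) $ i = (\<Sum>j<n. A $$ (i, j) * (\<Sum>l<k. ?P (k - 1 - l) l $ j))"
    using Suc A x by (auto simp: scalar_prod_def lessThan_atLeast0)
  also have "\<dots> = (\<Sum>l<k. \<Sum>j<n. A $$ (i, j) * ?P (k - 1 - l) l $ j)"
    unfolding sum_distrib_left by (rule sum.swap)
  also have "\<dots> = (\<Sum>l<k. (A *\<^sub>v ?P (k - 1 - l) l) $ i)"
    using Suc.prems A by (intro sum.cong) (auto simp: scalar_prod_def lessThan_atLeast0)
  also have "\<dots> = (\<Sum>l<k. ?P (k - l) l $ i)" using step by (intro sum.cong) auto
  finally show ?case using Suc.prems A B u x by simp
qed auto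

text \<open>Block $k$ of $\mathcal B_a U$ is the convolution that gives $\overline x(k+1)$, hence the cost is
  the squared norm of $\mathcal B_a U$.\<close>

lemma P2_cost_eq_quadratic_form:
  assumes A: "A \<in> carrier_mat n n" and B: "B \<in> carrier_mat n m" and U: "U \<in> carrier_vec (T * m)"
  shows "P2_cost T A B (0\<^sub>v n) U = U \<bullet> ((B_stack T A B)\<^sup>T * B_stack T A B *\<^sub>v U)"
proof -
  define D where "D = B_stack T A B"
  have D: "D \<in> carrier_mat (T * n) (T * m)"
    using B by (auto simp: D_def B_stack_def lower_block_toeplitz_def block_mat_def)
  have block: "attack n (D *\<^sub>v U) k = mean_state A B (0\<^sub>v n) U (Suc k)" if k: "k < T" for k
  proof (rule eq_vecI)
    have dim: "dim_vec (mean_state A B (0\<^sub>v n) U (Suc k)) = n" using A B by simp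
    then show "dim_vec (attack n (D *\<^sub>v U) k) = dim_vec (mean_state A B (0\<^sub>v n) U (Suc k))"
      by (simp add: attack_def)
    fix i assume "i < dim_vec (mean_state A B (0\<^sub>v n) U (Suc k))"
    with dim have i: "i < n" by simp
    have carr: "A ^\<^sub>m j * B \<in> carrier_mat n m" for j
    by (rule mult_carrier_mat[OF pow_carrier_mat[OF A] B])
    have "attack n (D *\<^sub>v U) k $ i = (D *\<^sub>v U) $ (k * n + i)" using i by (simp add: attack_def)
    also have "\<dots> = (\<Sum>l<T. ((if l \<le> k then A ^\<^sub>m (k - l) * B else 0\<^sub>m n m) *\<^sub>v attack m U l) $ i)"
      using block_mat_mult_vec[of T "\<lambda>j l. if l \<le> j then A ^\<^sub>m (j - l) * B else 0\<^sub>m n m" k n m U T i]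
        k i U carr
      unfolding D_def B_stack_def lower_block_toeplitz_def carrier_matD[OF B]
      by (simp del: index_mult_mat_vec)
    also have "\<dots> = (\<Sum>l<T. if l \<le> k then ((A ^\<^sub>m (k - l) * B) *\<^sub>v attack m U l) $ i else 0)"
      using i by (intro sum.cong) (auto simp: attack_def)
    also have "\<dots> = (\<Sum>l<Suc k. ((A ^\<^sub>m (k - l) * B) *\<^sub>v attack m U l) $ i)"
      using k by (intro sum.mono_neutral_cong_right) auto
    also have "\<dots> = mean_state A B (0\<^sub>v n) U (Suc k) $ i"
      using mean_state_convolution[OF A B i, of U "Suc k"] by simp
    finally show "attack n (D *\<^sub>v U) k $ i = mean_state A B (0\<^sub>v n) U (Suc k) $ i" .
  qed
  have "P2_cost T A B (0\<^sub>v n) U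
      = (\<Sum>k<T. mean_state A B (0\<^sub>v n) U (Suc k) \<bullet> mean_state A B (0\<^sub>v n) U (Suc k))"
    unfolding P2_cost_def using sum.shift_bounds_cl_Suc_ivl
    by (simp add: sum.atLeast1_atMost_eq)
  also have "\<dots> = (D *\<^sub>v U) \<bullet> (D *\<^sub>v U)"
    using scalar_prod_blocks[of "D *\<^sub>v U" T n "D *\<^sub>v U"] D U block by simp
  also have "\<dots> = U \<bullet> (D\<^sup>T * D *\<^sub>v U)"
    using D U transpose_vec_mult_scalar[OF D U mult_mat_vec_carrier[OF D U]]
      comm_scalar_prod[of U "T * m" "D\<^sup>T *\<^sub>v (D *\<^sub>v U)"]
    by (simp add: assoc_mult_mat_vec[of _ "T * m" "T * n" _ "T * m"])
  finally show ?thesis by (simp add: D_def)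
qed

section \<open>Maximizing one quadratic form under a bound on another\<close>

text \<open>The bound $V^T S V \le r\, V^T M V \le \delta r$ holds for every feasible $V$, and the
  scaling makes $U^T M U = \delta$, so $U$ attains it because $S \nu = r M \nu$.\<close>

lemma P2_solution_scaled_eigenvector:
  assumes S: "covariance_mat (T * dim_col B) S" and M: "covariance_mat (T * dim_col B) M"
    and cost: "\<And>U. U \<in> carrier_vec (T * dim_col B) \<Longrightarrow> P2_cost T A B x0 U = U \<bullet> (S *\<^sub>v U)"
    and max: "max_gen_eigenpair S M (ereal r) \<nu>" and "0 \<le> \<delta>"
  defines "U \<equiv> sqrt (\<delta> / (\<nu> \<bullet> (M *\<^sub>v \<nu>))) \<cdot>\<^sub>v \<nu>"
  shows "P2_solution T A B x0 M (ereal \<delta>) U" "P2_cost T A B x0 U = \<delta> * r"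
proof -
  let ?n = "T * dim_col B"
  note Sc = covariance_matD[OF S] and Mc = covariance_matD[OF M]
  note pos = finite_max_gen_eigenpair_bounds(1)[OF S M max]
    and dom = finite_max_gen_eigenpair_bounds(2)[OF S M max]
  have \<nu>: "\<nu> \<in> carrier_vec ?n" "\<nu> \<noteq> 0\<^sub>v ?n" and eig: "S *\<^sub>v \<nu> = r \<cdot>\<^sub>v (M *\<^sub>v \<nu>)"
    using max Sc(1) by (auto simp: max_gen_eigenpair_def gen_eigenpair_def)
  define d where "d = \<nu> \<bullet> (M *\<^sub>v \<nu>)"
  have d: "0 < d" using pos[OF \<nu>] by (simp add: d_def)
  have Sd: "\<nu> \<bullet> (S *\<^sub>v \<nu>) = r * d" using eig \<nu>(1) Mc(1) by (simp add: d_def)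
  then have r: "0 \<le> r" using Sc(3)[OF \<nu>(1)] d by (simp add: zero_le_mult_iff)
  have U: "U \<in> carrier_vec ?n" using \<nu>(1) by (simp add: U_def)
  have UM: "U \<bullet> (M *\<^sub>v U) = \<delta>"
    using d \<open>0 \<le> \<delta>\<close> unfolding U_def quadratic_form_smult[OF Mc(1) \<nu>(1)] d_def[symmetric] by simp
  have US: "U \<bullet> (S *\<^sub>v U) = \<delta> * r"
    using d \<open>0 \<le> \<delta>\<close> unfolding U_def quadratic_form_smult[OF Sc(1) \<nu>(1)] Sd d_def[symmetric] by simp
  show cU: "P2_cost T A B x0 U = \<delta> * r" using cost[OF U] US by simp
  have "P2_cost T A B x0 V \<le> \<delta> * r" if "V \<in> P2_feasible T B M (ereal \<delta>)" for V
  proof -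
    have V: "V \<in> carrier_vec ?n" "V \<bullet> (M *\<^sub>v V) \<le> \<delta>"
      using that by (auto simp: P2_feasible_def)
    show ?thesis
      using cost[OF V(1)] dom[OF V(1)] mult_left_mono[OF V(2) r] by (simp add: mult.commute)
  qed
  then show "P2_solution T A B x0 M (ereal \<delta>) U"
    using U UM cU by (auto simp: P2_solution_def P2_feasible_def)
qed

text \<open>When the tolerance or the eigenvalue is infinite there may be no optimal attack, only the
  supremum remains. It is $\infty$ as soon as the line through $\nu$ is feasible and has positive
  cost; the remaining infinite case is $\widetilde\delta = \infty$ with eigenvalue $0$, where $S$
  has a vanishing form and the product $\infty \cdot 0 = 0$ of extended reals is the correct
  value. The excluded case $0 \cdot \infty$ is the one in which this convention gives $0$ although
  the supremum is $\infty$.\<close>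

lemma P2_value_eq:
  assumes S: "covariance_mat (T * dim_col B) S" and M: "covariance_mat (T * dim_col B) M"
    and cost: "\<And>U. U \<in> carrier_vec (T * dim_col B) \<Longrightarrow> P2_cost T A B x0 U = U \<bullet> (S *\<^sub>v U)"
    and max: "max_gen_eigenpair S M \<rho> \<nu>" and "0 \<le> \<delta>'" and "\<not> (\<delta>' = 0 \<and> \<rho> = \<infinity>)"
  shows "P2_value T A B x0 M \<delta>' = \<delta>' * \<rho>"
proof -
  let ?n = "T * dim_col B"
  note Sc = covariance_matD[OF S] and Mc = covariance_matD[OF M]
  have \<nu>: "\<nu> \<in> carrier_vec ?n" and eig: "gen_eigenpair S M \<rho> \<nu>"
    using max Sc(1) by (auto simp: max_gen_eigenpair_def gen_eigenpair_def)
  have unbounded: "P2_value T A B x0 M \<delta>' = \<infinity>"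
    if gain: "0 < \<nu> \<bullet> (S *\<^sub>v \<nu>)" and free: "\<delta>' = \<infinity> \<or> \<nu> \<bullet> (M *\<^sub>v \<nu>) = 0"
    unfolding P2_value_def
  proof (rule SUP_PInfty)
    fix k :: nat
    \<comment> \<open>the multiple of \<open>\<nu>\<close> whose cost is exactly \<open>k\<close>\<close>
    define s where "s = \<nu> \<bullet> (S *\<^sub>v \<nu>)"
    define U where "U = sqrt (real k / s) \<cdot>\<^sub>v \<nu>"
    have U: "U \<in> carrier_vec ?n" using \<nu> by (simp add: U_def)
    have "U \<bullet> (S *\<^sub>v U) = real k"
      using gain unfolding U_def quadratic_form_smult[OF Sc(1) \<nu>] s_def[symmetric] by simp
    moreover have "U \<in> P2_feasible T B M \<delta>'"
      using U free \<open>0 \<le> \<delta>'\<close> quadratic_form_smult[OF Mc(1) \<nu>] by (auto simp: P2_feasible_def U_def zero_ereal_def[symmetric])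
    ultimately show "\<exists>U\<in>P2_feasible T B M \<delta>'. ereal (real k) \<le> ereal (P2_cost T A B x0 U)"
      using cost[OF U] by (intro bexI[of _ U]) auto
  qed
  show ?thesis
  proof (cases \<rho>)
    case (real r)
    show ?thesis
    proof (cases \<delta>')
      case (real \<delta>)
      note opt = P2_solution_scaled_eigenvector[OF S M cost max[unfolded \<open>\<rho> = ereal r\<close>], of \<delta>]
      show ?thesis unfolding P2_value_def
      proof (rule antisym)
        show "(SUP U \<in> P2_feasible T B M \<delta>'. ereal (P2_cost T A B x0 U)) \<le> \<delta>' * \<rho>"
          using opt \<open>0 \<le> \<delta>'\<close> real \<open>\<rho> = ereal r\<close> by (intro SUP_least) (auto simp: P2_solution_def)
        show "\<delta>' * \<rho> \<le> (SUP U \<in> P2_feasible T B M \<delta>'. ereal (P2_cost T A B x0 U))"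
          using opt \<open>0 \<le> \<delta>'\<close> real \<open>\<rho> = ereal r\<close>
          by (intro SUP_upper2) (auto simp: P2_solution_def)
      qed
    next
      case PInf
      note pos = finite_max_gen_eigenpair_bounds(1)[OF S M max[unfolded real]]
        and dom = finite_max_gen_eigenpair_bounds(2)[OF S M max[unfolded real]]
      have "\<nu> \<noteq> 0\<^sub>v ?n" "S *\<^sub>v \<nu> = r \<cdot>\<^sub>v (M *\<^sub>v \<nu>)"
        using eig real Sc(1) by (auto simp: gen_eigenpair_def)
      then have d: "0 < \<nu> \<bullet> (M *\<^sub>v \<nu>)" "\<nu> \<bullet> (S *\<^sub>v \<nu>) = r * (\<nu> \<bullet> (M *\<^sub>v \<nu>))"
        using pos[OF \<nu>] \<nu> Mc(1) by auto
      then have r: "0 \<le> r" using Sc(3)[OF \<nu>] by (simp add: zero_le_mult_iff)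
      show ?thesis
      proof (cases "r = 0")
        case True
        have "P2_cost T A B x0 U = 0" if "U \<in> P2_feasible T B M \<delta>'" for U
        proof -
          have "U \<in> carrier_vec ?n" using that by (simp add: P2_feasible_def)
          from cost[OF this] dom[OF this] Sc(3)[OF this] True show ?thesis by simp
        qed
        moreover have "0\<^sub>v ?n \<in> P2_feasible T B M \<delta>'"
          using PInf by (auto simp: P2_feasible_def)
        ultimately show ?thesis unfolding P2_value_def
          using True PInf real
          by (subst SUP_eq_const[of _ _ 0]) (auto simp: zero_ereal_def[symmetric])
      next
        case False
        then show ?thesis using unbounded d r PInf real by simp
      qed
    qed (use \<open>0 \<le> \<delta>'\<close> in auto)
  next
    case PInf
    have M0: "\<nu> \<bullet> (M *\<^sub>v \<nu>) = 0" and "S *\<^sub>v \<nu> \<noteq> 0\<^sub>v ?n"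
      using eig PInf \<nu> Sc(1) Mc(1) by (auto simp: gen_eigenpair_def)
    then have "0 < \<nu> \<bullet> (S *\<^sub>v \<nu>)"
      using Sc(3)[OF \<nu>] covariance_mat_null_vector[OF S \<nu>] by force
    then have "P2_value T A B x0 M \<delta>' = \<infinity>" using unbounded M0 by blast
    moreover have "0 < \<delta>'" using assms(5,6) PInf by auto
    ultimately show ?thesis using PInf by simp
  next
    case MInf
    then show ?thesis using eig by (simp add: gen_eigenpair_def)
  qed
qed

section \<open>The optimal attack\<close>

theorem lemmaV2:
  fixes N T :: nat
    and ns ms rs :: "nat list"
    and Bs Cs Sws Svs :: "real mat list"
    and A B C Sw Sv Nc M S :: "real mat"
    and x0 :: "real vec"
    and \<tau> P\<^sub>F \<delta> :: real
    and \<delta>' :: ereal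
    and p :: nat
  assumes T: "0 < T"
    and N: "length ns = N" "length ms = N" "length rs = N"
      "length Bs = N" "length Cs = N" "length Sws = N" "length Svs = N"
    and blocks: "\<And>i. i < N \<Longrightarrow>
      Bs ! i \<in> carrier_mat (ns ! i) (ms ! i) \<and> Cs ! i \<in> carrier_mat (rs ! i) (ns ! i) \<and>
      Sws ! i \<in> carrier_mat (ns ! i) (ns ! i) \<and> Svs ! i \<in> carrier_mat (rs ! i) (rs ! i)"
    and attacked: "0 < sum_list ms"
    and A: "A \<in> carrier_mat (sum_list ns) (sum_list ns)"
    and B: "B = diag_block_mat Bs"
    and C: "C = diag_block_mat Cs"
    and Sw: "Sw = diag_block_mat Sws" "covariance_mat (sum_list ns) Sw"
    and Sv: "Sv = diag_block_mat Svs" "covariance_mat (sum_list rs) Sv"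
    and nontrivial: "mat_kernel ((obs_c T A C)\<^sup>T) \<noteq> {0\<^sub>v (T * sum_list rs)}"
    and Nc: "left_null_basis Nc (obs_c T A C)"
    and Sigma: "invertible_mat (Sigma_c T A C Sw Sv Nc)"
    and M: "M = M_c T A B C Sw Sv Nc"
    and S: "S = (B_stack T A B)\<^sup>T * B_stack T A B"
    and p: "p = vec_space.rank (dim_row Nc) (Sigma_c T A C Sw Sv Nc)"
    and \<tau>: "0 \<le> \<tau>" "chi_ccdf \<tau> p 0 = P\<^sub>F"
    and \<delta>: "P\<^sub>F \<le> \<delta>" "\<delta> \<le> 1"
    and \<delta>': "0 \<le> \<delta>'" "chi_ccdf \<tau> p \<delta>' = \<delta>"
    and x0: "x0 = 0\<^sub>v (sum_list ns)"
  shows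
    "((\<forall>\<nu> \<in> carrier_vec (T * sum_list ms).
         S *\<^sub>v \<nu> = 0\<^sub>v (T * sum_list ms) \<and> M *\<^sub>v \<nu> = 0\<^sub>v (T * sum_list ms)
           \<longrightarrow> \<nu> = 0\<^sub>v (T * sum_list ms))
        \<longrightarrow> (\<exists>\<rho> \<nu>. max_gen_eigenpair S M \<rho> \<nu>)) \<and>
     (\<forall>\<rho> \<nu>. max_gen_eigenpair S M \<rho> \<nu> \<longrightarrow>
        (\<delta>' < \<infinity> \<and> \<rho> < \<infinity> \<longrightarrow>
           (let U = sqrt (real_of_ereal \<delta>' / (\<nu> \<bullet> (M *\<^sub>v \<nu>))) \<cdot>\<^sub>v \<nu> in
              P2_solution T A B x0 M \<delta>' U \<and> ereal (P2_cost T A B x0 U) = \<delta>' * \<rho>)) \<and>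
        (\<not> (\<delta>' = 0 \<and> \<rho> = \<infinity>) \<longrightarrow>
           P2_value T A B x0 M \<delta>' = \<delta>' * \<rho>))"
proof -
  let ?n = "sum_list ns" and ?m = "sum_list ms" and ?r = "sum_list rs"
  have dims: "dim_row (Bs ! i) = ns ! i \<and> dim_col (Bs ! i) = ms ! i \<and>
      dim_row (Cs ! i) = rs ! i \<and> dim_col (Cs ! i) = ns ! i" if "i < N" for i
    using blocks[OF that] by auto
  have "map dim_row Bs = ns" "map dim_col Bs = ms" "map dim_row Cs = rs" "map dim_col Cs = ns"
    using N dims by (auto intro!: nth_equalityI)
  then have Bc: "B \<in> carrier_mat ?n ?m" and Cc: "C \<in> carrier_mat ?r ?n"
    by (auto simp: B C dim_diag_block_mat intro!: carrier_matI)
  have colB: "dim_col B = ?m" using Bc by simp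
  have "dim_col Nc = T * ?r"
    using Nc Cc by (simp add: left_null_basis_def obs_c_def block_mat_def)
  then have Mcov: "covariance_mat (T * ?m) M"
    unfolding M by (rule covariance_mat_M_c[OF A Bc Cc Sw(2) Sv(2) _ Sigma])
  have "B_stack T A B \<in> carrier_mat (T * ?n) (T * ?m)"
    using Bc by (auto simp: B_stack_def lower_block_toeplitz_def block_mat_def)
  then have Scov: "covariance_mat (T * ?m) S" unfolding S by (rule covariance_mat_Gram)
  have cost: "P2_cost T A B x0 U = U \<bullet> (S *\<^sub>v U)" if "U \<in> carrier_vec (T * ?m)" for U
    unfolding x0 S by (rule P2_cost_eq_quadratic_form[OF A Bc that])
  have "0 < T * ?m" using T attacked by simp
  note exist = max_gen_eigenpair_exists[OF this Scov Mcov]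
  show ?thesis
  proof (intro conjI allI impI)
    assume "\<forall>\<nu>\<in>carrier_vec (T * ?m). S *\<^sub>v \<nu> = 0\<^sub>v (T * ?m) \<and> M *\<^sub>v \<nu> = 0\<^sub>v (T * ?m)
      \<longrightarrow> \<nu> = 0\<^sub>v (T * ?m)"
    then show "\<exists>\<rho> \<nu>. max_gen_eigenpair S M \<rho> \<nu>" by (intro exist) blast
  next
    fix \<rho> \<nu>
    assume max: "max_gen_eigenpair S M \<rho> \<nu>" and fin: "\<delta>' < \<infinity> \<and> \<rho> < \<infinity>"
    have "\<rho> \<noteq> - \<infinity>" using max by (auto simp: max_gen_eigenpair_def gen_eigenpair_def)
    then obtain r d where r: "\<rho> = ereal r" and d: "\<delta>' = ereal d" "0 \<le> d"
      using fin \<delta>'(1) by (cases \<rho>; cases \<delta>') auto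
    define U where "U = sqrt (d / (\<nu> \<bullet> (M *\<^sub>v \<nu>))) \<cdot>\<^sub>v \<nu>"
    have "P2_solution T A B x0 M (ereal d) U" "P2_cost T A B x0 U = d * r"
      unfolding U_def using P2_solution_scaled_eigenvector[of T B S M A x0 r \<nu> d, unfolded colB]
        Scov Mcov cost max d(2) by (simp_all add: r)
    then show "let U = sqrt (real_of_ereal \<delta>' / (\<nu> \<bullet> (M *\<^sub>v \<nu>))) \<cdot>\<^sub>v \<nu> in
        P2_solution T A B x0 M \<delta>' U \<and> ereal (P2_cost T A B x0 U) = \<delta>' * \<rho>"
      by (simp add: U_def r d)
  next
    fix \<rho> \<nu>
    assume "max_gen_eigenpair S M \<rho> \<nu>" "\<not> (\<delta>' = 0 \<and> \<rho> = \<infinity>)"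
    then show "P2_value T A B x0 M \<delta>' = \<delta>' * \<rho>"
      using P2_value_eq[of T B S M A x0 \<rho> \<nu> \<delta>', unfolded colB] Scov Mcov cost \<delta>'(1) by blast
  qed
qed

end
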